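(* Let $X$ be a non-negative càdlàg submartingale with $X_0>0$. Then $$\mathbb{E}[\bar X_T]\ \le\ \frac{\mathbb{E}[X_T]}{\hat\alpha}\ =\ \frac{\mathbb{E}[X_T\ln X_T]+X_0-\mathbb{E}[X_T]\ln X_0}{1+\hat\alpha\ln\hat\alpha},$$ where $\hat\alpha\in(0,1)$ is uniquely defined by the equality in this display.
   Context: $T$ is a fixed time horizon and the constant $X_0$ is the initial value of $X$. Submartingales are with respect to their own natural filtration; $\bar X_T:=\sup_{t\le T}X_t$; $0\ln0:=0$.
   Formalization: E[X_T ln X_T] is assumed finite (otherwise no α̂ in (0,1) solves the equality), and α̂ in (0,1) is asserted only when X_T is not a.s. equal to X_0; if X_T = X_0 a.s., the only root in (0,1] is 1 and the bound is proved with it. *)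

theory Defs
  imports "HOL-Probability.Probability"
begin

text \<open>
  Processes are functions \<open>X :: real \<Rightarrow> 'a \<Rightarrow> real\<close> of which only the values
  \<open>X t\<close> with \<open>0 \<le> t \<le> T\<close> are relevant.
\<close>

definition natural_filtration :: "'a measure \<Rightarrow> (real \<Rightarrow> 'a \<Rightarrow> real) \<Rightarrow> real \<Rightarrow> 'a measure" where
  "natural_filtration M X t =
     sigma (space M) (\<Union>s\<in>{0..t}. {X s -` A \<inter> space M | A. A \<in> sets borel})"

definition submartingale ::
  "'a measure \<Rightarrow> (real \<Rightarrow> 'a measure) \<Rightarrow> real \<Rightarrow> (real \<Rightarrow> 'a \<Rightarrow> real) \<Rightarrow> bool" where
  "submartingale M F T X \<longleftrightarrow>
     filtration (space M) F \<and>
     (\<forall>t\<in>{0..T}. subalgebra M (F t)) \<and>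
     (\<forall>t\<in>{0..T}. X t \<in> borel_measurable (F t)) \<and>
     (\<forall>t\<in>{0..T}. integrable M (X t)) \<and>
     (\<forall>s t. 0 \<le> s \<and> s \<le> t \<and> t \<le> T \<longrightarrow>
        (AE \<omega> in M. X s \<omega> \<le> real_cond_exp M (F s) (X t) \<omega>))"

definition cadlag_on :: "real \<Rightarrow> (real \<Rightarrow> real) \<Rightarrow> bool" where
  "cadlag_on T f \<longleftrightarrow>
     (\<forall>t\<in>{0..<T}. (f \<longlongrightarrow> f t) (at_right t)) \<and>
     (\<forall>t\<in>{0<..T}. \<exists>l. (f \<longlongrightarrow> l) (at_left t))"

text \<open>
  A cadlag function is bounded on \<open>{0..T}\<close>, so for cadlag paths the conditionally
  complete \<open>SUP\<close> on the reals is the actual supremum.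
\<close>

definition running_max :: "real \<Rightarrow> (real \<Rightarrow> 'a \<Rightarrow> real) \<Rightarrow> 'a \<Rightarrow> real" where
  "running_max T X \<omega> = (SUP t\<in>{0..T}. X t \<omega>)"

text \<open>
  The equality that determines \<open>\<alpha>\<close>. Since \<open>0 * y = 0\<close> on the reals, the term
  \<open>X T \<omega> * ln (X T \<omega>)\<close> obeys the convention \<open>0 ln 0 = 0\<close>. The denominator
  \<open>1 + \<alpha> ln \<alpha>\<close> is at least \<open>1 - 1/e > 0\<close> for \<open>\<alpha> > 0\<close>.
\<close>

definition alpha_equality ::
  "'a measure \<Rightarrow> real \<Rightarrow> (real \<Rightarrow> 'a \<Rightarrow> real) \<Rightarrow> real \<Rightarrow> real \<Rightarrow> bool" where
  "alpha_equality M T X x0 \<alpha> \<longleftrightarrow>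
     (\<integral>\<omega>. X T \<omega> \<partial>M) / \<alpha> =
     ((\<integral>\<omega>. X T \<omega> * ln (X T \<omega>) \<partial>M) + x0 - (\<integral>\<omega>. X T \<omega> \<partial>M) * ln x0)
       / (1 + \<alpha> * ln \<alpha>)"

end

theory Submission
  imports Defs
begin

text \<open>
  Write \<open>m = E[X\<^sub>T]\<close>, \<open>N = E[X\<^sub>T ln X\<^sub>T] + x\<^sub>0 - m ln x\<^sub>0\<close> and
  \<open>g(a) = 1/a + ln a\<close>. After clearing denominators the equation for \<open>\<alpha>\<close> is
  \<open>m g(\<alpha>) = N\<close>. The function \<open>g\<close> decreases strictly from \<open>\<infinity>\<close> to \<open>1\<close> on
  \<open>(0, 1]\<close>, so everything about \<open>\<alpha>\<close> follows from the comparison of \<open>N\<close> with \<open>m\<close>.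
  Here \<open>N - m\<close> is the expectation of \<open>x ln x - x ln x\<^sub>0 + x\<^sub>0 - x\<close> at
  \<open>x = X\<^sub>T\<close>, which is non-negative and vanishes only at \<open>x = x\<^sub>0\<close>; thus \<open>N > m\<close>
  unless \<open>X\<^sub>T = x\<^sub>0\<close> almost surely, and then \<open>N = m\<close>.

  The bound on the maximum is Doob's \<open>L log L\<close> argument in a pathwise form. Let \<open>Y\<close> be
  the maximum of \<open>X\<close> over a finite set of times. When a new, later time \<open>b\<close>
  raises the maximum from \<open>Y\<close> to \<open>Y'\<close>, then \<open>Y' = X\<^sub>b\<close>, and
  \<open>ln u \<le> u - 1\<close> gives \<open>Y' - Y \<le> X\<^sub>b (ln Y' - ln Y)\<close>. The
  factor \<open>ln Y' - ln Y\<close> is non-negative and known at time \<open>b\<close>, so the submartingale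
  property allows \<open>X\<^sub>b\<close> to be replaced by \<open>X\<^sub>T\<close> under the expectation. The increments
  telescope to \<open>E[Y] - x\<^sub>0 \<le> E[X\<^sub>T (ln Y - ln x\<^sub>0)]\<close>
  (lemma \<open>finite_max_log_bound\<close>). The same inequality for the logarithm bounds
  \<open>X\<^sub>T ln Y\<close> by \<open>X\<^sub>T ln X\<^sub>T + \<beta> Y - X\<^sub>T - X\<^sub>T ln \<beta>\<close> for
  every \<open>\<beta> > 0\<close>; after solving for \<open>E[Y]\<close>, any \<open>\<beta> < 1\<close> with
  \<open>N \<le> m g(\<beta>)\<close> yields \<open>E[Y] \<le> m / \<beta>\<close>. All \<open>\<beta> < \<alpha>\<close> satisfy
  this because \<open>g\<close> is decreasing, and \<open>\<beta> \<rightarrow> \<alpha>\<close> gives \<open>E[Y] \<le> m / \<alpha>\<close>,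
  also in the degenerate case \<open>\<alpha> = 1\<close>.

  This bound is uniform in the finite set of times. Along an increasing sequence of finite sets that
  exhausts a countable dense set, the maxima increase to the supremum of the whole cadlag
  path, and monotone convergence finishes the proof.
\<close>

section \<open>Elementary inequalities for the logarithm\<close>

text \<open>
  For \<open>x > 0\<close> this is \<open>ln u \<le> u - 1\<close> at \<open>u = \<beta> y / x\<close>. It is the Young inequality
  that separates the product of the terminal value with the logarithm of the maximum; the free
  parameter \<open>\<beta>\<close> becomes the coefficient of the maximum.
\<close>

lemma mult_ln_le_young:
  fixes x y \<beta> :: real
  assumes "0 \<le> x" "0 < y" "0 < \<beta>"
  shows "x * ln y \<le> x * ln x + \<beta> * y - x - x * ln \<beta>"
proof (cases "x = 0")
  case False
  with assms have x: "0 < x" by simp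
  have "ln (\<beta> * y / x) \<le> \<beta> * y / x - 1"
    by (rule ln_le_minus_one) (use x assms in simp)
  then have "x * ln (\<beta> * y / x) \<le> x * (\<beta> * y / x - 1)"
    using x by (intro mult_left_mono) auto
  also have "\<dots> = \<beta> * y - x"
    using x by (simp add: field_simps)
  finally show ?thesis
    using x assms by (simp add: ln_mult ln_div algebra_simps)
qed (use assms in simp)

text \<open>
  Only \<open>x > m\<close> matters, where the maximum equals \<open>x\<close> and the claim is
  \<open>ln u \<le> u - 1\<close> at \<open>u = m / x\<close>. Replacing the increment by an increment of logarithms is
  what makes the sum over successive times telescope after \<open>x\<close> has been exchanged for a
  common terminal value.
\<close>

lemma max_increment_le_log_increment:
  fixes m x :: real
  assumes "0 < m"
  shows "max m x - m \<le> x * (ln (max m x) - ln m)"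
proof (cases "x \<le> m")
  case False
  with assms have x: "0 < x" "m < x" by auto
  have "ln (m / x) \<le> m / x - 1"
    by (rule ln_le_minus_one) (use x assms in simp)
  then have "x * ln (m / x) \<le> x * (m / x - 1)"
    using x by (intro mult_left_mono) auto
  also have "\<dots> = m - x"
    using x by (simp add: field_simps)
  finally show ?thesis
    using x assms by (simp add: ln_div max_def algebra_simps)
qed (use assms in simp)

text \<open>
  The tangent line of the convex function \<open>x ln x\<close> at \<open>c\<close> is \<open>x ln c + x - c\<close>; the
  deficit below is the gap between the two, hence zero only at the point of tangency.
\<close>

lemma entropy_deficit_nonneg:
  fixes x c :: real
  assumes "0 \<le> x" "0 < c"
  shows "0 \<le> x * ln x - x * ln c + c - x"
  using mult_ln_le_young[of x c 1] assms by simp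

lemma entropy_deficit_eq_0_iff:
  fixes x c :: real
  assumes "0 \<le> x" "0 < c"
  shows "x * ln x - x * ln c + c - x = 0 \<longleftrightarrow> x = c"
proof
  assume eq: "x * ln x - x * ln c + c - x = 0"
  with assms have x: "0 < x" by (cases "x = 0") auto
  have "x * ln (c / x) = c - x"
    using eq x assms by (simp add: ln_div algebra_simps)
  then have "ln (c / x) = c / x - 1"
    using x by (simp add: field_simps)
  then have "c / x = 1"
    by (intro ln_eq_minus_one) (use x assms in auto)
  then show "x = c" using x by simp
qed simp

section \<open>The equation that determines \<open>\<alpha>\<close>\<close>

definition inv_plus_ln :: "real \<Rightarrow> real" where
  "inv_plus_ln a = 1 / a + ln a"

lemma inv_plus_ln_strict_antimono:
  assumes "0 < a" "a < b" "b \<le> 1"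
  shows "inv_plus_ln b < inv_plus_ln a"
proof -
  have "ln (b / a) \<noteq> b / a - 1"
    using ln_eq_minus_one[of "b / a"] assms by auto
  moreover have "ln (b / a) \<le> b / a - 1"
    by (rule ln_le_minus_one) (use assms in simp)
  ultimately have "ln b - ln a < b / a - 1"
    using assms by (simp add: ln_div)
  also have "\<dots> = (b - a) / a"
    using assms by (simp add: field_simps)
  also have "\<dots> \<le> (b - a) / a / b"
    using assms by (simp add: le_divide_eq mult_left_le)
  also have "\<dots> = 1 / a - 1 / b"
    using assms by (simp add: field_simps)
  finally show ?thesis
    by (simp add: inv_plus_ln_def)
qed

lemma one_plus_mult_ln_pos:
  fixes a :: real
  assumes "0 < a"
  shows "0 < 1 + a * ln a"
  using entropy_deficit_nonneg[of a 1] assms by simp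

lemma inv_plus_ln_surj:
  assumes "1 < c"
  shows "\<exists>a\<in>{0<..<1}. inv_plus_ln a = c"
proof -
  \<comment> \<open>The value at \<open>exp (- s)\<close> is \<open>exp s - s \<ge> 1 + s\<^sup>2 / 2\<close>, and \<open>s\<close> is chosen to make
      this lower bound equal to \<open>c\<close>.\<close>
  define s where "s = sqrt (2 * (c - 1))"
  have s: "0 < s" "s\<^sup>2 = 2 * (c - 1)" using assms by (auto simp: s_def)
  have "1 + s + s\<^sup>2 / 2 \<le> exp s"
    by (rule exp_lower_Taylor_quadratic) (use s in simp)
  then have "c \<le> exp s - s"
    using s by (simp add: field_simps)
  also have "exp s - s = inv_plus_ln (exp (- s))"
    unfolding inv_plus_ln_def ln_exp by (simp add: exp_minus inverse_eq_divide)
  finally have ge: "c \<le> inv_plus_ln (exp (- s))" .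
  have "a \<noteq> 0" if "a \<in> {exp (- s)..1}" for a
    using that exp_gt_zero[of "- s"] by (simp del: exp_gt_zero)
  then have cont: "continuous_on {exp (- s)..1} inv_plus_ln"
    unfolding inv_plus_ln_def by (intro continuous_intros) auto
  have "\<exists>a\<ge>exp (- s). a \<le> 1 \<and> inv_plus_ln a = c"
    by (rule IVT2'[OF _ _ _ cont]) (use ge s assms in \<open>auto simp: inv_plus_ln_def\<close>)
  then obtain a where a: "exp (- s) \<le> a" "a \<le> 1" "inv_plus_ln a = c" by blast
  have "0 < a" using a(1) exp_gt_zero[of "- s"] by linarith
  moreover have "a \<noteq> 1" using a(3) assms by (auto simp: inv_plus_ln_def)
  ultimately show ?thesis using a by (intro bexI[of _ a]) auto
qed

section \<open>Cadlag paths\<close>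

text \<open>
  Near each time the one-sided limits bound the path on either side, so compactness of the
  interval gives a global bound. This makes the conditionally complete supremum
  in the running maximum an actual one on every path.
\<close>

lemma cadlag_on_bdd_above:
  assumes "cadlag_on T f"
  shows "bdd_above (f ` {0..T})"
proof -
  have "\<exists>U B. open U \<and> t \<in> U \<and> (\<forall>s\<in>U \<inter> {0..T}. f s \<le> B)" if t: "t \<in> {0..T}" for t
  proof -
    have "\<exists>b>t. \<forall>s>t. s < b \<and> s \<le> T \<longrightarrow> f s \<le> f t + 1"
    proof (cases "t = T")
      case True
      then show ?thesis by (intro exI[of _ "T + 1"]) auto
    next
      case False
      with t assms have "(f \<longlongrightarrow> f t) (at_right t)"
        by (auto simp: cadlag_on_def)
      then have "\<forall>\<^sub>F s in at_right t. f s < f t + 1"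
        by (rule order_tendstoD) simp
      then obtain b where "b > t" "\<And>s. s > t \<Longrightarrow> s < b \<Longrightarrow> f s < f t + 1"
        by (auto simp: eventually_at_right_field)
      then show ?thesis by (intro exI[of _ b]) (auto intro: less_imp_le)
    qed
    then obtain b where b: "b > t" "\<And>s. s > t \<Longrightarrow> s < b \<Longrightarrow> s \<le> T \<Longrightarrow> f s \<le> f t + 1"
      by blast
    have "\<exists>a<t. \<exists>C. \<forall>s<t. a < s \<and> 0 \<le> s \<longrightarrow> f s \<le> C"
    proof (cases "t = 0")
      case True
      then show ?thesis by (intro exI[of _ "-1"]) auto
    next
      case False
      with t have "t \<in> {0<..T}" by auto
      with assms obtain l where "(f \<longlongrightarrow> l) (at_left t)"
        unfolding cadlag_on_def by blast
      then have "\<forall>\<^sub>F s in at_left t. f s < l + 1"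
        by (rule order_tendstoD) simp
      then obtain a where "a < t" "\<And>s. s > a \<Longrightarrow> s < t \<Longrightarrow> f s < l + 1"
        by (auto simp: eventually_at_left_field)
      then show ?thesis by (intro exI[of _ a]) (auto intro!: exI[of _ "l + 1"] less_imp_le)
    qed
    then obtain a C where a: "a < t" "\<And>s. s < t \<Longrightarrow> a < s \<Longrightarrow> 0 \<le> s \<Longrightarrow> f s \<le> C"
      by blast
    have "f s \<le> max C (f t + 1)" if "s \<in> {a<..<b} \<inter> {0..T}" for s
      using a(2)[of s] b(2)[of s] that by (cases s t rule: linorder_cases) auto
    then show ?thesis
      using a(1) b(1) by (intro exI[of _ "{a<..<b}"] exI[of _ "max C (f t + 1)"]) auto
  qed
  then obtain U B where U: "\<And>t. t \<in> {0..T} \<Longrightarrow> open (U t)" "\<And>t. t \<in> {0..T} \<Longrightarrow> t \<in> U t"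
    and B: "\<And>t s. t \<in> {0..T} \<Longrightarrow> s \<in> U t \<inter> {0..T} \<Longrightarrow> f s \<le> B t"
    by metis
  have cover: "{0..T} \<subseteq> (\<Union>t\<in>{0..T}. U t)" using U(2) by blast
  obtain K where K: "K \<subseteq> {0..T}" "finite K" "{0..T} \<subseteq> (\<Union>t\<in>K. U t)"
    by (rule compactE_image[OF compact_Icc U(1) cover])
  show ?thesis
  proof (rule bdd_aboveI2)
    fix s assume s: "s \<in> {0..T}"
    then obtain t where t: "t \<in> K" "s \<in> U t" using K(3) by blast
    with s K(1) have "f s \<le> B t" by (intro B) auto
    also have "\<dots> \<le> Max (B ` K)" using K(2) t(1) by simp
    finally show "f s \<le> Max (B ` K)" .
  qed
qed

text \<open>
  The horizon is added because right-continuity says nothing there: the path may jump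
  at an irrational \<open>T\<close>.
\<close>

definition rational_times :: "real \<Rightarrow> real set" where
  "rational_times T = insert T (\<rat> \<inter> {0..T})"

lemma countable_rational_times: "countable (rational_times T)"
  unfolding rational_times_def by (intro countable_insert countable_Int1 countable_rat)

lemma cadlag_on_exceeds_at_rational_time:
  assumes "cadlag_on T f" "t \<in> {0..T}" "c < f t"
  shows "\<exists>d\<in>rational_times T. c < f d"
proof (cases "t = T")
  case True
  with assms show ?thesis by (auto simp: rational_times_def)
next
  case False
  with assms have "(f \<longlongrightarrow> f t) (at_right t)"
    by (auto simp: cadlag_on_def)
  then have "\<forall>\<^sub>F s in at_right t. c < f s"
    using assms(3) by (rule order_tendstoD)
  then obtain b where b: "b > t" "\<And>s. s > t \<Longrightarrow> s < b \<Longrightarrow> c < f s"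
    by (auto simp: eventually_at_right_field)
  have "t < min b T" using b(1) False assms(2) by auto
  then obtain d where "d \<in> \<rat>" "t < d" "d < min b T"
    using Rats_dense_in_real by blast
  then show ?thesis
    using b(2) assms(2) by (auto simp: rational_times_def intro!: bexI[of _ d])
qed

definition first_rational_times :: "real \<Rightarrow> nat \<Rightarrow> real set" where
  "first_rational_times T n = from_nat_into (rational_times T) ` {..n}"

lemma finite_first_rational_times [simp]: "finite (first_rational_times T n)"
  by (simp add: first_rational_times_def)

lemma first_rational_times_subset:
  assumes "0 \<le> T"
  shows "first_rational_times T n \<subseteq> {0..T}"
proof -
  have "from_nat_into (rational_times T) k \<in> rational_times T" for k
    by (rule from_nat_into) (simp add: rational_times_def)
  moreover have "rational_times T \<subseteq> {0..T}"
    using assms by (auto simp: rational_times_def)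
  ultimately show ?thesis by (auto simp: first_rational_times_def)
qed

lemma cadlag_on_Max_first_rational_times_tendsto:
  assumes "0 \<le> T" "cadlag_on T f"
  shows "(\<lambda>n. Max (f ` insert 0 (first_rational_times T n))) \<longlonglongrightarrow> (SUP t\<in>{0..T}. f t)"
proof (rule increasing_tendsto)
  have bdd: "bdd_above (f ` {0..T})" by (rule cadlag_on_bdd_above[OF assms(2)])
  show "\<forall>\<^sub>F n in sequentially.
      Max (f ` insert 0 (first_rational_times T n)) \<le> (SUP t\<in>{0..T}. f t)"
  proof (rule always_eventually, rule allI)
    fix n
    have "f t \<le> (SUP t\<in>{0..T}. f t)" if "t \<in> insert 0 (first_rational_times T n)" for t
      using that first_rational_times_subset[OF assms(1), of n] assms(1)
      by (intro cSUP_upper bdd) auto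
    then show "Max (f ` insert 0 (first_rational_times T n)) \<le> (SUP t\<in>{0..T}. f t)"
      by (subst Max_le_iff) auto
  qed
next
  fix c assume "c < (SUP t\<in>{0..T}. f t)"
  then obtain t where "t \<in> {0..T}" "c < f t"
    using less_cSUP_iff[OF _ cadlag_on_bdd_above[OF assms(2)]] assms(1) by auto
  then obtain d where d: "d \<in> rational_times T" "c < f d"
    using cadlag_on_exceeds_at_rational_time[OF assms(2)] by blast
  then obtain k where k: "d = from_nat_into (rational_times T) k"
    using from_nat_into_surj[OF countable_rational_times] by metis
  show "\<forall>\<^sub>F n in sequentially. c < Max (f ` insert 0 (first_rational_times T n))"
    using eventually_ge_at_top[of k]
  proof eventually_elim
    case (elim n)
    then have "d \<in> first_rational_times T n" by (auto simp: first_rational_times_def k)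
    then show ?case using d(2) by (subst Max_gr_iff) auto
  qed
qed

section \<open>The maximum of a submartingale over finitely many times\<close>

locale nonneg_submartingale = prob_space M
  for M :: "'a measure" +
  fixes F :: "real \<Rightarrow> 'a measure" and T :: real and X :: "real \<Rightarrow> 'a \<Rightarrow> real" and x0 :: real
  assumes T_nonneg: "0 \<le> T"
    and submart: "submartingale M F T X"
    and X_nonneg: "\<And>t \<omega>. t \<in> {0..T} \<Longrightarrow> \<omega> \<in> space M \<Longrightarrow> 0 \<le> X t \<omega>"
    and X_0: "\<And>\<omega>. \<omega> \<in> space M \<Longrightarrow> X 0 \<omega> = x0"
    and x0_pos: "0 < x0"
    and integrable_X_ln_X: "integrable M (\<lambda>\<omega>. X T \<omega> * ln (X T \<omega>))"
begin

lemma integrable_X: "t \<in> {0..T} \<Longrightarrow> integrable M (X t)"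
  using submart by (auto simp: submartingale_def)

lemma X_measurable_later:
  assumes "s \<in> {0..T}" "t \<in> {0..T}" "s \<le> t"
  shows "X s \<in> borel_measurable (F t)"
proof -
  have F: "filtration (space M) F" and X: "X s \<in> borel_measurable (F s)"
    using submart assms by (auto simp: submartingale_def)
  have "subalgebra (F t) (F s)"
    using filtration.space_F[OF F] filtration.sets_F_mono[OF F assms(3)]
    by (simp add: subalgebra_def)
  then show ?thesis using X by (rule measurable_from_subalg)
qed

text \<open>
  A weight known at time \<open>s\<close> may be moved inside the conditional expectation of
  the terminal value, which dominates the value at time \<open>s\<close>.
  This domination also makes the product with the earlier value integrable, since that product
  is non-negative.
\<close>

lemma integral_mult_le_terminal:
  assumes s: "s \<in> {0..T}"
    and Z: "Z \<in> borel_measurable (F s)" "\<And>\<omega>. \<omega> \<in> space M \<Longrightarrow> 0 \<le> Z \<omega>"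
    and int: "integrable M (\<lambda>\<omega>. Z \<omega> * X T \<omega>)"
  shows "integrable M (\<lambda>\<omega>. Z \<omega> * X s \<omega>)"
    and "(\<integral>\<omega>. Z \<omega> * X s \<omega> \<partial>M) \<le> (\<integral>\<omega>. Z \<omega> * X T \<omega> \<partial>M)"
proof -
  have sub: "subalgebra M (F s)" using submart s by (auto simp: submartingale_def)
  interpret finite_measure_subalgebra M "F s"
    by unfold_locales (rule sub)
  have XT: "X T \<in> borel_measurable M"
    using integrable_X[of T] T_nonneg by auto
  have Xs: "X s \<in> borel_measurable M" using integrable_X[OF s] by auto
  have ZM: "Z \<in> borel_measurable M" by (rule measurable_from_subalg[OF sub Z(1)])
  note ce = real_cond_exp_intg[OF int Z(1) XT]
  have le: "AE \<omega> in M. X s \<omega> \<le> real_cond_exp M (F s) (X T) \<omega>"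
    using submart s by (auto simp: submartingale_def)
  have le': "AE \<omega> in M. Z \<omega> * X s \<omega> \<le> Z \<omega> * real_cond_exp M (F s) (X T) \<omega>"
    using le AE_space by eventually_elim (intro mult_left_mono Z(2))
  show i: "integrable M (\<lambda>\<omega>. Z \<omega> * X s \<omega>)"
  proof (rule Bochner_Integration.integrable_bound[OF ce(1)])
    show "(\<lambda>\<omega>. Z \<omega> * X s \<omega>) \<in> borel_measurable M" using ZM Xs by measurable
    show "AE \<omega> in M. norm (Z \<omega> * X s \<omega>) \<le> norm (Z \<omega> * real_cond_exp M (F s) (X T) \<omega>)"
      using le' AE_space
    proof eventually_elim
      case (elim \<omega>)
      moreover have "0 \<le> Z \<omega> * X s \<omega>" using elim Z(2) X_nonneg[OF s] by simp
      ultimately show ?case by simp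
    qed
  qed
  show "(\<integral>\<omega>. Z \<omega> * X s \<omega> \<partial>M) \<le> (\<integral>\<omega>. Z \<omega> * X T \<omega> \<partial>M)"
    using integral_mono_AE[OF i ce(1) le'] ce(2) by simp
qed

lemma x0_le_mean: "x0 \<le> (\<integral>\<omega>. X T \<omega> \<partial>M)"
proof -
  have "(\<integral>\<omega>. 1 * X 0 \<omega> \<partial>M) \<le> (\<integral>\<omega>. 1 * X T \<omega> \<partial>M)"
    by (rule integral_mult_le_terminal(2)) (use T_nonneg integrable_X[of T] in auto)
  moreover have "(\<integral>\<omega>. X 0 \<omega> \<partial>M) = (\<integral>\<omega>. x0 \<partial>M)"
    by (intro Bochner_Integration.integral_cong) (auto simp: X_0)
  ultimately show ?thesis by (simp add: prob_space)
qed

text \<open>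
  Time \<open>0\<close> is always included, so that the maximum is at least \<open>x0 > 0\<close> and its logarithm
  is harmless.
\<close>

definition finite_max :: "real set \<Rightarrow> 'a \<Rightarrow> real" where
  "finite_max S \<omega> = Max ((\<lambda>t. X t \<omega>) ` insert 0 S)"

lemma finite_max_empty: "\<omega> \<in> space M \<Longrightarrow> finite_max {} \<omega> = x0"
  by (simp add: finite_max_def X_0)

lemma finite_max_insert:
  assumes "finite S"
  shows "finite_max (insert b S) \<omega> = max (finite_max S \<omega>) (X b \<omega>)"
proof -
  have "(\<lambda>t. X t \<omega>) ` insert 0 (insert b S) = insert (X b \<omega>) ((\<lambda>t. X t \<omega>) ` insert 0 S)"
    by auto
  then show ?thesis using assms by (simp add: finite_max_def max.commute)
qed

lemma finite_max_ge_x0: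
  assumes "finite S" "\<omega> \<in> space M"
  shows "x0 \<le> finite_max S \<omega>"
  using assms unfolding finite_max_def by (intro Max_ge) (auto simp: X_0)

lemma finite_max_mono:
  assumes "finite S'" "S \<subseteq> S'"
  shows "finite_max S \<omega> \<le> finite_max S' \<omega>"
  unfolding finite_max_def using assms by (intro Max_mono) auto

lemma integrable_finite_max:
  assumes "finite S" "S \<subseteq> {0..T}"
  shows "integrable M (finite_max S)"
  using assms
proof (induction S)
  case empty
  have "integrable M (finite_max {}) \<longleftrightarrow> integrable M (\<lambda>_. x0)"
    by (rule Bochner_Integration.integrable_cong) (auto simp: finite_max_empty)
  then show ?case by simp
next
  case (insert b S)
  then have "integrable M (\<lambda>\<omega>. max (finite_max S \<omega>) (X b \<omega>))"
    by (intro integrable_max integrable_X) auto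
  also have "(\<lambda>\<omega>. max (finite_max S \<omega>) (X b \<omega>)) = finite_max (insert b S)"
    using insert by (auto simp: finite_max_insert)
  finally show ?case .
qed

lemma finite_max_measurable:
  assumes "finite S" "S \<subseteq> {0..b}" "b \<in> {0..T}"
  shows "finite_max S \<in> borel_measurable (F b)"
proof -
  have "(\<lambda>\<omega>. Max ((\<lambda>t. X t \<omega>) ` insert 0 S)) \<in> borel_measurable (F b)"
    by (rule borel_measurable_Max) (use assms in \<open>auto intro!: X_measurable_later\<close>)
  then show ?thesis by (simp add: finite_max_def[abs_def])
qed

text \<open>
  The product is squeezed between \<open>X\<^sub>T ln x\<^sub>0\<close> and the Young bound with
  \<open>\<beta> = 1\<close>, both of which are integrable.
\<close>

lemma integrable_X_ln_finite_max:
  assumes "finite S" "S \<subseteq> {0..T}"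
  shows "integrable M (\<lambda>\<omega>. X T \<omega> * ln (finite_max S \<omega>))"
proof -
  let ?U = "\<lambda>\<omega>. X T \<omega> * ln (X T \<omega>) + 1 * finite_max S \<omega> - X T \<omega> - X T \<omega> * ln 1"
  have T: "T \<in> {0..T}" using T_nonneg by simp
  note [measurable] = borel_measurable_integrable[OF integrable_finite_max[OF assms]]
    borel_measurable_integrable[OF integrable_X[OF T]]
  show ?thesis
  proof (rule Bochner_Integration.integrable_bound)
    show "integrable M (\<lambda>\<omega>. \<bar>?U \<omega>\<bar> + \<bar>X T \<omega> * ln x0\<bar>)"
      using integrable_X_ln_X integrable_X[OF T] integrable_finite_max[OF assms]
      by (intro Bochner_Integration.integrable_add integrable_abs Bochner_Integration.integrable_diff) auto
    show "(\<lambda>\<omega>. X T \<omega> * ln (finite_max S \<omega>)) \<in> borel_measurable M" by measurable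
    show "AE \<omega> in M. norm (X T \<omega> * ln (finite_max S \<omega>)) \<le> norm (\<bar>?U \<omega>\<bar> + \<bar>X T \<omega> * ln x0\<bar>)"
    proof (rule AE_I2)
      fix \<omega> assume \<omega>: "\<omega> \<in> space M"
      note ge = finite_max_ge_x0[OF assms(1) \<omega>]
      have "X T \<omega> * ln (finite_max S \<omega>) \<le> ?U \<omega>"
        by (rule mult_ln_le_young) (use ge x0_pos X_nonneg[OF T \<omega>] in auto)
      moreover have "X T \<omega> * ln x0 \<le> X T \<omega> * ln (finite_max S \<omega>)"
        using ge x0_pos X_nonneg[OF T \<omega>] by (intro mult_left_mono) auto
      ultimately show "norm (X T \<omega> * ln (finite_max S \<omega>)) \<le> norm (\<bar>?U \<omega>\<bar> + \<bar>X T \<omega> * ln x0\<bar>)"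
        by simp
    qed
  qed
qed

text \<open>
  Induction on the times in increasing order: since the new time \<open>b\<close> is the latest, both
  the old and the new maximum are measurable at time \<open>b\<close>, which is what is needed to replace
  \<open>X\<^sub>b\<close> by \<open>X\<^sub>T\<close> in the increment.
\<close>

lemma finite_max_log_bound:
  assumes "finite S" "S \<subseteq> {0..T}"
  shows "(\<integral>\<omega>. finite_max S \<omega> \<partial>M) - x0
    \<le> (\<integral>\<omega>. X T \<omega> * ln (finite_max S \<omega>) \<partial>M) - (\<integral>\<omega>. X T \<omega> \<partial>M) * ln x0"
  using assms
proof (induction S rule: finite_linorder_max_induct)
  case empty
  have "(\<integral>\<omega>. finite_max {} \<omega> \<partial>M) = (\<integral>\<omega>. x0 \<partial>M)"
    by (intro Bochner_Integration.integral_cong) (auto simp: finite_max_empty)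
  moreover have "(\<integral>\<omega>. X T \<omega> * ln (finite_max {} \<omega>) \<partial>M) = (\<integral>\<omega>. X T \<omega> * ln x0 \<partial>M)"
    by (intro Bochner_Integration.integral_cong) (auto simp: finite_max_empty)
  ultimately show ?case by (simp add: prob_space)
next
  case (insert b S)
  let ?S' = "insert b S"
  have b: "b \<in> {0..T}" and S: "S \<subseteq> {0..T}"
    using insert.prems by auto
  have Sb: "S \<subseteq> {0..b}" and S': "finite ?S'" "?S' \<subseteq> {0..b}"
    using insert.hyps S b by (force intro: less_imp_le)+
  define Z where "Z \<omega> = ln (finite_max ?S' \<omega>) - ln (finite_max S \<omega>)" for \<omega>
  note int = integrable_finite_max[OF insert.hyps(1) S] integrable_finite_max[OF S'(1) insert.prems]
    integrable_X_ln_finite_max[OF insert.hyps(1) S] integrable_X_ln_finite_max[OF S'(1) insert.prems]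
  have Z_measurable: "Z \<in> borel_measurable (F b)"
    unfolding Z_def using finite_max_measurable[OF insert.hyps(1) Sb b] finite_max_measurable[OF S' b]
    by measurable
  have Z_nonneg: "0 \<le> Z \<omega>" if "\<omega> \<in> space M" for \<omega>
    using finite_max_ge_x0[OF insert.hyps(1) that] finite_max_mono[OF S'(1) subset_insertI, of \<omega>] x0_pos
    by (simp add: Z_def)
  have ZX: "(\<lambda>\<omega>. Z \<omega> * X T \<omega>)
      = (\<lambda>\<omega>. X T \<omega> * ln (finite_max ?S' \<omega>) - X T \<omega> * ln (finite_max S \<omega>))"
    by (auto simp: Z_def algebra_simps)
  have int_ZX: "integrable M (\<lambda>\<omega>. Z \<omega> * X T \<omega>)"
    unfolding ZX using int by (intro Bochner_Integration.integrable_diff)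
  note dom = integral_mult_le_terminal[OF b Z_measurable Z_nonneg int_ZX]
  have "(\<integral>\<omega>. finite_max ?S' \<omega> \<partial>M) - (\<integral>\<omega>. finite_max S \<omega> \<partial>M)
      = (\<integral>\<omega>. finite_max ?S' \<omega> - finite_max S \<omega> \<partial>M)"
    using int by simp
  also have "\<dots> \<le> (\<integral>\<omega>. Z \<omega> * X b \<omega> \<partial>M)"
  proof (rule integral_mono)
    fix \<omega> assume \<omega>: "\<omega> \<in> space M"
    have "0 < finite_max S \<omega>" using finite_max_ge_x0[OF insert.hyps(1) \<omega>] x0_pos by simp
    from max_increment_le_log_increment[OF this, of "X b \<omega>"]
    show "finite_max ?S' \<omega> - finite_max S \<omega> \<le> Z \<omega> * X b \<omega>"
      using insert.hyps(1) by (simp add: Z_def finite_max_insert mult.commute)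
  qed (use int dom(1) in auto)
  also have "\<dots> \<le> (\<integral>\<omega>. Z \<omega> * X T \<omega> \<partial>M)" by (rule dom(2))
  also have "\<dots> = (\<integral>\<omega>. X T \<omega> * ln (finite_max ?S' \<omega>) \<partial>M) - (\<integral>\<omega>. X T \<omega> * ln (finite_max S \<omega>) \<partial>M)"
    unfolding ZX using int by simp
  finally show ?case using insert.IH[OF S] by simp
qed

text \<open>
  The numerator on the right-hand side of the equation that determines \<open>\<alpha>\<close>.
\<close>

definition entropy_term :: real where
  "entropy_term = (\<integral>\<omega>. X T \<omega> * ln (X T \<omega>) \<partial>M) + x0 - (\<integral>\<omega>. X T \<omega> \<partial>M) * ln x0"

text \<open>
  Inserting the Young bound into the logarithmic bound leaves \<open>\<beta> E\<close> on the right, where \<open>E\<close> is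
  the mean of the maximum; \<open>\<beta> < 1\<close> and the finiteness of \<open>E\<close> allow solving for it.
\<close>

lemma mean_finite_max_le:
  assumes "finite S" "S \<subseteq> {0..T}" "0 < \<beta>" "\<beta> < 1"
    and "entropy_term \<le> (\<integral>\<omega>. X T \<omega> \<partial>M) * inv_plus_ln \<beta>"
  shows "(\<integral>\<omega>. finite_max S \<omega> \<partial>M) \<le> (\<integral>\<omega>. X T \<omega> \<partial>M) / \<beta>"
proof -
  have T: "T \<in> {0..T}" using T_nonneg by simp
  note int = integrable_X_ln_X integrable_X[OF T] integrable_finite_max[OF assms(1,2)]
  define m where "m = (\<integral>\<omega>. X T \<omega> \<partial>M)"
  define E where "E = (\<integral>\<omega>. finite_max S \<omega> \<partial>M)"
  have "(\<integral>\<omega>. X T \<omega> * ln (finite_max S \<omega>) \<partial>M)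
      \<le> (\<integral>\<omega>. X T \<omega> * ln (X T \<omega>) + \<beta> * finite_max S \<omega> - X T \<omega> - X T \<omega> * ln \<beta> \<partial>M)"
  proof (rule integral_mono)
    fix \<omega> assume \<omega>: "\<omega> \<in> space M"
    show "X T \<omega> * ln (finite_max S \<omega>)
        \<le> X T \<omega> * ln (X T \<omega>) + \<beta> * finite_max S \<omega> - X T \<omega> - X T \<omega> * ln \<beta>"
      by (rule mult_ln_le_young)
        (use finite_max_ge_x0[OF assms(1) \<omega>] x0_pos X_nonneg[OF T \<omega>] assms in auto)
  qed (use int integrable_X_ln_finite_max[OF assms(1,2)] in auto)
  also have "\<dots> = (\<integral>\<omega>. X T \<omega> * ln (X T \<omega>) \<partial>M) + \<beta> * E - m - m * ln \<beta>"
    unfolding m_def E_def using int by simp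
  finally have "E \<le> entropy_term + \<beta> * E - m - m * ln \<beta>"
    using finite_max_log_bound[OF assms(1,2)] by (simp add: entropy_term_def m_def E_def)
  also have "\<dots> \<le> m * inv_plus_ln \<beta> + \<beta> * E - m - m * ln \<beta>"
    using assms(5) by (simp add: m_def)
  also have "\<dots> = \<beta> * E + (m / \<beta> - m)"
    by (simp add: inv_plus_ln_def algebra_simps)
  also have "m / \<beta> - m = (1 - \<beta>) * (m / \<beta>)"
    using assms(3) by (simp add: field_simps)
  finally have "(1 - \<beta>) * E \<le> (1 - \<beta>) * (m / \<beta>)"
    unfolding left_diff_distrib by linarith
  then have "E \<le> m / \<beta>"
    by (rule mult_left_le_imp_le) (use assms(4) in simp)
  then show ?thesis by (simp add: E_def m_def)
qed

text \<open>
  Taking \<open>\<beta> = \<alpha>\<close> directly would leave out \<open>\<alpha> = 1\<close>, where solving for the mean divides by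
  zero. Approaching \<open>\<alpha>\<close> from the left covers both cases.
\<close>

lemma mean_finite_max_le_of_alpha:
  assumes S: "finite S" "S \<subseteq> {0..T}" and \<alpha>: "0 < \<alpha>" "\<alpha> \<le> 1"
    and eq: "entropy_term = (\<integral>\<omega>. X T \<omega> \<partial>M) * inv_plus_ln \<alpha>"
  shows "(\<integral>\<omega>. finite_max S \<omega> \<partial>M) \<le> (\<integral>\<omega>. X T \<omega> \<partial>M) / \<alpha>"
proof (rule tendsto_lowerbound)
  show "((\<lambda>\<beta>. (\<integral>\<omega>. X T \<omega> \<partial>M) / \<beta>) \<longlongrightarrow> (\<integral>\<omega>. X T \<omega> \<partial>M) / \<alpha>) (at_left \<alpha>)"
    using \<alpha> by (intro tendsto_intros) auto
  have "\<forall>\<^sub>F \<beta> in at_left \<alpha>. \<beta> \<in> {0<..<\<alpha>}"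
    by (rule eventually_at_leftI[OF _ \<alpha>(1)])
  then show "\<forall>\<^sub>F \<beta> in at_left \<alpha>. (\<integral>\<omega>. finite_max S \<omega> \<partial>M) \<le> (\<integral>\<omega>. X T \<omega> \<partial>M) / \<beta>"
  proof eventually_elim
    case (elim \<beta>)
    then have "inv_plus_ln \<alpha> \<le> inv_plus_ln \<beta>"
      using inv_plus_ln_strict_antimono[of \<beta> \<alpha>] \<alpha> by simp
    then have "entropy_term \<le> (\<integral>\<omega>. X T \<omega> \<partial>M) * inv_plus_ln \<beta>"
      unfolding eq using x0_le_mean x0_pos by (intro mult_left_mono) auto
    then show ?case using elim \<alpha> by (intro mean_finite_max_le[OF S]) auto
  qed
qed simp

section \<open>The bound for cadlag paths\<close>

lemma mean_running_max_le:
  assumes cadlag: "\<And>\<omega>. \<omega> \<in> space M \<Longrightarrow> cadlag_on T (\<lambda>t. X t \<omega>)"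
    and \<alpha>: "0 < \<alpha>" "\<alpha> \<le> 1"
    and eq: "entropy_term = (\<integral>\<omega>. X T \<omega> \<partial>M) * inv_plus_ln \<alpha>"
  shows "integrable M (running_max T X)"
    and "(\<integral>\<omega>. running_max T X \<omega> \<partial>M) \<le> (\<integral>\<omega>. X T \<omega> \<partial>M) / \<alpha>"
proof -
  let ?m = "\<lambda>n. finite_max (first_rational_times T n)"
  note sub = first_rational_times_subset[OF T_nonneg]
  note int = integrable_finite_max[OF finite_first_rational_times sub]
  have mono: "?m i \<omega> \<le> ?m j \<omega>" if "i \<le> j" for i j \<omega>
    by (rule finite_max_mono) (use that in \<open>auto simp: first_rational_times_def\<close>)
  have lim: "(\<lambda>n. ?m n \<omega>) \<longlonglongrightarrow> running_max T X \<omega>" if "\<omega> \<in> space M" for \<omega>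
    unfolding finite_max_def running_max_def
    by (rule cadlag_on_Max_first_rational_times_tendsto[OF T_nonneg cadlag[OF that]])
  have le: "(\<integral>\<omega>. ?m n \<omega> \<partial>M) \<le> (\<integral>\<omega>. X T \<omega> \<partial>M) / \<alpha>" for n
    by (rule mean_finite_max_le_of_alpha[OF finite_first_rational_times sub \<alpha> eq])
  have "incseq (\<lambda>n. \<integral>\<omega>. ?m n \<omega> \<partial>M)"
    by (intro incseq_SucI integral_mono int mono) simp
  then obtain L where L: "(\<lambda>n. \<integral>\<omega>. ?m n \<omega> \<partial>M) \<longlonglongrightarrow> L"
    using incseq_convergent[of "\<lambda>n. \<integral>\<omega>. ?m n \<omega> \<partial>M"] le by metis
  have meas: "running_max T X \<in> borel_measurable M"
    by (rule borel_measurable_LIMSEQ_real[OF lim]) (use int in auto)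
  have mono_AE: "AE \<omega> in M. mono (\<lambda>n. ?m n \<omega>)"
    using mono by (auto simp: mono_def)
  have lim_AE: "AE \<omega> in M. (\<lambda>n. ?m n \<omega>) \<longlonglongrightarrow> running_max T X \<omega>"
    using lim by (rule AE_I2)
  show "integrable M (running_max T X)"
    by (rule integrable_monotone_convergence[OF int mono_AE lim_AE L meas])
  have "(\<integral>\<omega>. running_max T X \<omega> \<partial>M) = L"
    by (rule integral_monotone_convergence[OF int mono_AE lim_AE L meas])
  also have "L \<le> (\<integral>\<omega>. X T \<omega> \<partial>M) / \<alpha>"
    by (rule LIMSEQ_le_const2[OF L]) (use le in auto)
  finally show "(\<integral>\<omega>. running_max T X \<omega> \<partial>M) \<le> (\<integral>\<omega>. X T \<omega> \<partial>M) / \<alpha>" .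
qed

section \<open>Existence and uniqueness of \<open>\<alpha>\<close>\<close>

lemma alpha_equality_iff:
  assumes "0 < \<alpha>"
  shows "alpha_equality M T X x0 \<alpha> \<longleftrightarrow> entropy_term = (\<integral>\<omega>. X T \<omega> \<partial>M) * inv_plus_ln \<alpha>"
proof -
  define m where "m = (\<integral>\<omega>. X T \<omega> \<partial>M)"
  have "alpha_equality M T X x0 \<alpha> \<longleftrightarrow> m / \<alpha> = entropy_term / (1 + \<alpha> * ln \<alpha>)"
    by (simp add: alpha_equality_def entropy_term_def m_def)
  also have "\<dots> \<longleftrightarrow> entropy_term * \<alpha> = m * (1 + \<alpha> * ln \<alpha>)"
    using assms one_plus_mult_ln_pos[OF assms] by (auto simp: frac_eq_eq)
  also have "m * (1 + \<alpha> * ln \<alpha>) = m * inv_plus_ln \<alpha> * \<alpha>"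
    using assms by (simp add: inv_plus_ln_def algebra_simps)
  finally show ?thesis using assms by (simp add: m_def)
qed

text \<open>
  The difference of the two sides is the expectation of the non-negative entropy deficit
  of \<open>X\<^sub>T\<close> at \<open>x\<^sub>0\<close>.
\<close>

lemma entropy_term_ge_mean:
  shows "(\<integral>\<omega>. X T \<omega> \<partial>M) \<le> entropy_term"
    and "entropy_term = (\<integral>\<omega>. X T \<omega> \<partial>M) \<longleftrightarrow> (AE \<omega> in M. X T \<omega> = x0)"
proof -
  let ?d = "\<lambda>\<omega>. X T \<omega> * ln (X T \<omega>) - X T \<omega> * ln x0 + x0 - X T \<omega>"
  have T: "T \<in> {0..T}" using T_nonneg by simp
  note int = integrable_X_ln_X integrable_X[OF T]
  have d: "(\<integral>\<omega>. ?d \<omega> \<partial>M) = entropy_term - (\<integral>\<omega>. X T \<omega> \<partial>M)"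
    using int by (simp add: entropy_term_def prob_space)
  have nonneg: "0 \<le> ?d \<omega>" if "\<omega> \<in> space M" for \<omega>
    using entropy_deficit_nonneg X_nonneg[OF T that] x0_pos by blast
  have "0 \<le> (\<integral>\<omega>. ?d \<omega> \<partial>M)"
    by (rule Bochner_Integration.integral_nonneg) (rule nonneg)
  then show "(\<integral>\<omega>. X T \<omega> \<partial>M) \<le> entropy_term" using d by simp
  have "(\<integral>\<omega>. ?d \<omega> \<partial>M) = 0 \<longleftrightarrow> (AE \<omega> in M. ?d \<omega> = 0)"
    by (rule integral_nonneg_eq_0_iff_AE) (use int nonneg in auto)
  also have "\<dots> \<longleftrightarrow> (AE \<omega> in M. X T \<omega> = x0)"
    using entropy_deficit_eq_0_iff[OF X_nonneg[OF T] x0_pos] by (intro AE_cong) simp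
  finally show "entropy_term = (\<integral>\<omega>. X T \<omega> \<partial>M) \<longleftrightarrow> (AE \<omega> in M. X T \<omega> = x0)"
    using d by simp
qed

end

section \<open>The maximal inequality\<close>

theorem corollary3p5:
  fixes M :: "'a measure" and X :: "real \<Rightarrow> 'a \<Rightarrow> real" and T x0 :: real
  assumes "prob_space M"
    and "0 \<le> T"
    and "submartingale M (natural_filtration M X) T X"
    and "\<And>\<omega>. \<omega> \<in> space M \<Longrightarrow> cadlag_on T (\<lambda>t. X t \<omega>)"
    and "\<And>t \<omega>. t \<in> {0..T} \<Longrightarrow> \<omega> \<in> space M \<Longrightarrow> 0 \<le> X t \<omega>"
    and "\<And>\<omega>. \<omega> \<in> space M \<Longrightarrow> X 0 \<omega> = x0"
    and "0 < x0"
    and "integrable M (\<lambda>\<omega>. X T \<omega> * ln (X T \<omega>))"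
  shows "(\<not> (AE \<omega> in M. X T \<omega> = x0) \<longrightarrow>
            (\<exists>!\<alpha>. \<alpha> \<in> {0<..<1} \<and> alpha_equality M T X x0 \<alpha>)) \<and>
         ((AE \<omega> in M. X T \<omega> = x0) \<longrightarrow>
            (\<forall>\<alpha>\<in>{0<..1}. alpha_equality M T X x0 \<alpha> \<longleftrightarrow> \<alpha> = 1)) \<and>
         (\<forall>\<alpha>\<in>{0<..1}. alpha_equality M T X x0 \<alpha> \<longrightarrow>
            integrable M (running_max T X) \<and>
            (\<integral>\<omega>. running_max T X \<omega> \<partial>M) \<le> (\<integral>\<omega>. X T \<omega> \<partial>M) / \<alpha>)"
proof -
  interpret nonneg_submartingale M "natural_filtration M X" T X x0
    using assms by (auto simp: nonneg_submartingale_def nonneg_submartingale_axioms_def)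
  define m where "m = (\<integral>\<omega>. X T \<omega> \<partial>M)"
  have m: "0 < m" using x0_le_mean x0_pos by (simp add: m_def)
  have iff: "alpha_equality M T X x0 \<alpha> \<longleftrightarrow> inv_plus_ln \<alpha> = entropy_term / m" if "0 < \<alpha>" for \<alpha>
    using alpha_equality_iff[OF that] m by (auto simp: m_def field_simps)
  have unique: "\<alpha> = \<beta>"
    if "\<alpha> \<in> {0<..1}" "\<beta> \<in> {0<..1}" "inv_plus_ln \<alpha> = inv_plus_ln \<beta>" for \<alpha> \<beta>
    using inv_plus_ln_strict_antimono[of \<alpha> \<beta>] inv_plus_ln_strict_antimono[of \<beta> \<alpha>] that
    by (cases \<alpha> \<beta> rule: linorder_cases) auto
  have "\<exists>!\<alpha>. \<alpha> \<in> {0<..<1} \<and> alpha_equality M T X x0 \<alpha>" if "\<not> (AE \<omega> in M. X T \<omega> = x0)"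
  proof -
    have "1 < entropy_term / m"
      using entropy_term_ge_mean that m by (simp add: m_def)
    then obtain \<alpha> where \<alpha>: "\<alpha> \<in> {0<..<1}" "inv_plus_ln \<alpha> = entropy_term / m"
      using inv_plus_ln_surj by blast
    show ?thesis
      by (rule ex1I[of _ \<alpha>]) (use \<alpha> iff unique[of _ \<alpha>] in auto)
  qed
  moreover have "alpha_equality M T X x0 \<alpha> \<longleftrightarrow> \<alpha> = 1"
    if "AE \<omega> in M. X T \<omega> = x0" "\<alpha> \<in> {0<..1}" for \<alpha>
  proof -
    have "entropy_term / m = inv_plus_ln 1"
      using entropy_term_ge_mean(2) that(1) m by (simp add: m_def inv_plus_ln_def)
    then show ?thesis using iff[of \<alpha>] that(2) unique[of \<alpha> 1] by auto
  qed
  moreover have "integrable M (running_max T X) \<and>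
      (\<integral>\<omega>. running_max T X \<omega> \<partial>M) \<le> (\<integral>\<omega>. X T \<omega> \<partial>M) / \<alpha>"
    if "\<alpha> \<in> {0<..1}" "alpha_equality M T X x0 \<alpha>" for \<alpha>
    using mean_running_max_le[OF assms(4)] alpha_equality_iff[of \<alpha>] that by auto
  ultimately show ?thesis by blast
qed

end
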